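(* The only Cameron-Liebler line classes in $\mathrm{AG}(3,4)$ are the trivial ones, i.e. every Cameron-Liebler line class in $\mathrm{AG}(3,4)$ is either the empty set, the set of all lines through some affine point, the complement (in the set of all lines of $\mathrm{AG}(3,4)$) of the set of all lines through some affine point, or the set of all lines of $\mathrm{AG}(3,4)$.
   Context: $\mathrm{AG}(3,4)$ is the 3-dimensional affine space over $\mathbb{F}_4$. A line spread of $\mathrm{AG}(3,4)$ is a set of pairwise disjoint lines of $\mathrm{AG}(3,4)$ that partitions the points of $\mathrm{AG}(3,4)$. A Cameron-Liebler line class of parameter $x$ in $\mathrm{AG}(3,4)$ is a set $\mathcal{L}$ of lines of $\mathrm{AG}(3,4)$ such that $|\mathcal{L}\cap\mathcal{S}|=x$ for every line spread $\mathcal{S}$ of $\mathrm{AG}(3,4)$; a Cameron-Liebler line class is one of some parameter $x$. *)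

theory Defs
  imports "HOL-Analysis.Analysis"
begin

text \<open>The points of the 3-dimensional affine space over a field are the vectors of type
  \<^typ>\<open>'a ^ 3\<close>; a line is identified with its set of points.\<close>

definition AG_lines :: "('a::field ^ 3) set set" where
  "AG_lines = {{p + t *s v | t. True} | p v. v \<noteq> 0}"

definition line_spread :: "('a::field ^ 3) set set \<Rightarrow> bool" where
  "line_spread S \<longleftrightarrow> S \<subseteq> AG_lines \<and> partition_on UNIV S"

definition lines_through :: "'a::field ^ 3 \<Rightarrow> ('a ^ 3) set set" where
  "lines_through p = {l \<in> AG_lines. p \<in> l}"

definition CL_line_class_param :: "nat \<Rightarrow> ('a::{field,finite} ^ 3) set set \<Rightarrow> bool" where
  "CL_line_class_param x L \<longleftrightarrow>
     L \<subseteq> AG_lines \<and> (\<forall>S. line_spread S \<longrightarrow> card (L \<inter> S) = x)"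

definition CL_line_class :: "('a::{field,finite} ^ 3) set set \<Rightarrow> bool" where
  "CL_line_class L \<longleftrightarrow> (\<exists>x. CL_line_class_param x L)"

end

theory Submission
  imports Defs
begin

text \<open>Replacing, inside one plane of a parallel class of lines, one direction by another
  shows that the lines of \<open>L\<close> in a plane are equidistributed over its parallel classes. Hence
  \<open>g p = (n p - x) / 5\<close>, where \<open>n p\<close> is the number of lines of \<open>L\<close> on \<open>p\<close> and \<open>x\<close> the parameter,
  is an integer, and the sum of \<open>g\<close> over a line is 4 or 0 according to whether the line is in
  \<open>L\<close>. Summing \<open>g\<close> against its line sums gives the second moments
  \<open>\<Sum>g\<^sup>2 = 4x(21 - x) / 5\<close> in the space, so \<open>x \<equiv> 0, 1 (mod 5)\<close>, and \<open>\<Sum>g\<^sup>2 = 4a(5 - a)\<close> in a plane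
  with \<open>\<Sum>g = 4a\<close>. Replacing \<open>L\<close> by its complement, that is \<open>g\<close> by \<open>1 - g\<close>, leaves \<open>x \<in> {0, 1, 5, 6}\<close>;
  for \<open>x \<le> 1\<close> the second moment determines \<open>g\<close>.

  For \<open>x = 5\<close>, four parallel planes have \<open>\<Sum>a = 5\<close> and \<open>\<Sum>a\<^sup>2 = 9\<close>, so one of them has \<open>a = 2\<close>. On it
  \<open>g \<ge> 0\<close>, \<open>\<Sum>g = 8\<close> and \<open>\<Sum>g\<^sup>2 = 24\<close>, which is incompatible with line sums at most 4.

  For \<open>x = 6\<close>, a point with \<open>g = 3\<close> has all its lines in \<open>L\<close>, and removing them reduces to \<open>x = 5\<close>; so
  \<open>-1 \<le> g \<le> 2\<close>. At least 10 points have \<open>g = -1\<close>, so by the moments at most 34 have \<open>g = 0\<close>. A point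
  with \<open>g = -1\<close> lies on a unique line of \<open>L\<close>, and every plane through that line has \<open>a = 2\<close>. As
  \<open>\<Sum>a = 6\<close> and \<open>\<Sum>a\<^sup>2 = 12\<close> over each parallel class, every such plane is parallel to one on which \<open>g\<close>
  vanishes. Three pairwise non-parallel such planes have at least 36 zeros of \<open>g\<close>.\<close>

section \<open>Line sums\<close>

text \<open>The sum runs over the parameter of the line, so for \<open>v = 0\<close> it is
  \<open>CARD('a)\<close> times \<open>g p\<close>. The codomain is general because the weight
  attached to a line class is real-valued until it is shown to be integral.\<close>

definition line_sum :: "('a::{field,finite} ^ 'n \<Rightarrow> 'b::comm_ring_1) \<Rightarrow> 'a ^ 'n \<Rightarrow> 'a ^ 'n \<Rightarrow> 'b" where
  "line_sum g p v = (\<Sum>k\<in>UNIV. g (p + k *s v))"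

lemma sum_shift:
  fixes f :: "'a::{group_add,finite} \<Rightarrow> 'b::comm_monoid_add"
  shows "(\<Sum>z\<in>UNIV. f (z + c)) = (\<Sum>z\<in>UNIV. f z)" "(\<Sum>z\<in>UNIV. f (c + z)) = (\<Sum>z\<in>UNIV. f z)"
proof -
  show "(\<Sum>z\<in>UNIV. f (z + c)) = (\<Sum>z\<in>UNIV. f z)"
    by (rule sum.reindex_bij_witness[where i="\<lambda>z. z - c" and j="\<lambda>z. z + c"]) auto
  show "(\<Sum>z\<in>UNIV. f (c + z)) = (\<Sum>z\<in>UNIV. f z)"
    by (rule sum.reindex_bij_witness[where i="\<lambda>z. - c + z" and j="\<lambda>z. c + z"]) (auto simp: add.assoc[symmetric])
qed

lemma sum_scale_vec:
  fixes f :: "'a::{field,finite} ^ 'n \<Rightarrow> 'b::comm_monoid_add"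
  assumes "c \<noteq> 0" "\<And>v. c *s v \<in> A \<longleftrightarrow> v \<in> A"
  shows "(\<Sum>v\<in>A. f (c *s v)) = (\<Sum>v\<in>A. f v)"
proof (rule sum.reindex_bij_witness[where i="\<lambda>v. inverse c *s v" and j="\<lambda>v. c *s v"])
  show "inverse c *s b \<in> A" if "b \<in> A" for b
    using assms that by (metis right_inverse vector_smult_assoc vector_smult_lid)
qed (use assms in \<open>auto simp: vector_smult_assoc\<close>)

lemma card_nonzero: "card (- {0 :: 'a::{zero,finite}}) = CARD('a) - 1"
  by (simp add: Compl_eq_Diff_UNIV card_Diff_singleton)

lemma line_sum_translate: "line_sum g (p + c *s v) v = line_sum g p v"
proof -
  have "line_sum g (p + c *s v) v = (\<Sum>k\<in>UNIV. g (p + (c + k) *s v))"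
    by (simp add: line_sum_def vector_sadd_rdistrib add.assoc)
  also have "\<dots> = line_sum g p v"
    unfolding line_sum_def by (rule sum_shift(2)[of "\<lambda>k. g (p + k *s v)"])
  finally show ?thesis .
qed

lemma line_sum_scale:
  assumes "c \<noteq> 0"
  shows "line_sum g p (c *s v) = line_sum g p v"
  unfolding line_sum_def
  by (rule sum.reindex_bij_witness[where i="\<lambda>k. k / c" and j="\<lambda>k. k * c"])
    (use assms in \<open>auto simp: vector_smult_assoc\<close>)

lemma sum_line_sum:
  fixes g :: "'a::{field,finite} ^ 'n \<Rightarrow> 'b::comm_ring_1"
  shows "(\<Sum>p\<in>UNIV. line_sum g p v) = of_nat CARD('a) * (\<Sum>p\<in>UNIV. g p)"
proof -
  have "(\<Sum>p\<in>UNIV. line_sum g p v) = (\<Sum>k\<in>UNIV. \<Sum>p\<in>UNIV. g (p + k *s v))"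
    unfolding line_sum_def by (rule sum.swap)
  then show ?thesis by (simp add: sum_shift(1))
qed

text \<open>Directions are counted as nonzero vectors, so each line on \<open>p\<close> occurs three
  times. The parameter 0 always contributes \<open>g p\<close>; each of the three nonzero parameters
  \<open>k\<close> runs, as \<open>v\<close> varies, over all points other than
  \<open>p\<close>.\<close>

lemma sum_line_sum_directions:
  fixes g :: "'a::{field,finite} ^ 'n \<Rightarrow> 'b::comm_ring_1"
  assumes q4: "CARD('a) = 4"
  shows "(\<Sum>v\<in>-{0}. line_sum g p v) = of_nat (CARD('a ^ 'n) - 4) * g p + 3 * (\<Sum>z\<in>UNIV. g z)"
proof -
  let ?M = "CARD('a ^ 'n)"
  have card0: "card (- {0 :: 'a ^ 'n}) = ?M - 1"
    by (simp add: card_nonzero)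
  have M: "?M \<ge> 4"
    by (simp add: q4 self_le_power Suc_le_eq)
  have ck: "card (- {0::'a}) = 3"
    by (simp add: card_nonzero q4)
  have split: "line_sum g p v = g p + (\<Sum>k\<in>-{0}. g (p + k *s v))" for v
    unfolding line_sum_def by (subst sum.remove[of _ 0]) (auto simp: Compl_eq_Diff_UNIV)
  have scale: "(\<Sum>v\<in>-{0}. g (p + k *s v)) = (\<Sum>z\<in>UNIV. g z) - g p" if "k \<noteq> 0" for k
  proof -
    have "(\<Sum>v\<in>-{0}. g (p + k *s v)) = (\<Sum>v\<in>-{0}. g (p + v))"
      by (rule sum_scale_vec[of k _ "\<lambda>v. g (p + v)"]) (use that in auto)
    also have "\<dots> = (\<Sum>v\<in>UNIV. g (p + v)) - g p"
      by (subst sum.remove[of UNIV 0]) (auto simp: Compl_eq_Diff_UNIV)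
    finally show ?thesis by (simp add: sum_shift(2))
  qed
  have "(\<Sum>v\<in>-{0}. line_sum g p v)
      = of_nat (?M - 1) * g p + (\<Sum>k\<in>-{0}. \<Sum>v\<in>-{0}. g (p + k *s v))"
    unfolding split sum.distrib by (subst (2) sum.swap) (simp add: card0)
  also have "(\<Sum>k\<in>-{0}. \<Sum>v\<in>-{0}. g (p + k *s v)) = 3 * ((\<Sum>z\<in>UNIV. g z) - g p)"
    by (simp add: scale ck)
  also have "of_nat (?M - 1) * g p = of_nat (?M - 4) * g p + 3 * g p"
  proof -
    have "?M - 1 = (?M - 4) + 3" using M by simp
    then show ?thesis by (metis distrib_right of_nat_add of_nat_numeral)
  qed
  finally show ?thesis by (simp add: algebra_simps)
qed

section \<open>Second moments of functions with line sums 0 and 4, in any dimension\<close>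

definition binary_line_sums :: "('a::{field,finite} ^ 'n \<Rightarrow> int) \<Rightarrow> bool" where
  "binary_line_sums g \<longleftrightarrow> (\<forall>p v. v \<noteq> 0 \<longrightarrow> line_sum g p v \<in> {0, 4})"

lemma binary_line_sumsD: "binary_line_sums g \<Longrightarrow> v \<noteq> 0 \<Longrightarrow> line_sum g p v = 0 \<or> line_sum g p v = 4"
  by (auto simp: binary_line_sums_def)

text \<open>For the \<open>g\<close> attached to a line class, these are the direction vectors of
  its lines on \<open>p\<close>, three for each line.\<close>

definition full_directions :: "('a::{field,finite} ^ 'n \<Rightarrow> int) \<Rightarrow> 'a ^ 'n \<Rightarrow> ('a ^ 'n) set" where
  "full_directions g p = {v. v \<noteq> 0 \<and> line_sum g p v = 4}"

lemma card_full_directions: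
  fixes g :: "'a::{field,finite} ^ 'n \<Rightarrow> int"
  assumes q4: "CARD('a) = 4" and g: "binary_line_sums g"
  shows "4 * int (card (full_directions g p)) = int (CARD('a ^ 'n) - 4) * g p + 3 * (\<Sum>z\<in>UNIV. g z)"
proof -
  have "(\<Sum>v\<in>-{0}. line_sum g p v) = (\<Sum>v\<in>-{0}. if v \<in> full_directions g p then 4 else 0)"
    by (rule sum.cong) (use binary_line_sumsD[OF g] in \<open>auto simp: full_directions_def\<close>)
  also have "\<dots> = 4 * int (card (full_directions g p))"
    by (simp add: sum.If_cases full_directions_def Int_def)
  finally show ?thesis
    using sum_line_sum_directions[OF q4, of g p] by simp
qed

text \<open>Double counting of the sum of \<open>g p * line_sum g p v\<close> over all
  \<open>p\<close> and all \<open>v \<noteq> 0\<close>. Summing over \<open>v\<close> first gives a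
  quadratic expression in \<open>g\<close>; summing over \<open>p\<close> first is linear, because a
  line sum \<open>s\<close> satisfies \<open>s * s = 4 * s\<close>.\<close>

lemma quadratic_identity:
  fixes g :: "'a::{field,finite} ^ 'n \<Rightarrow> int"
  assumes q4: "CARD('a) = 4" and g: "binary_line_sums g"
  shows "int (CARD('a ^ 'n) - 4) * (\<Sum>z\<in>UNIV. (g z)\<^sup>2) + 3 * (\<Sum>z\<in>UNIV. g z)\<^sup>2
       = 4 * int (CARD('a ^ 'n) - 1) * (\<Sum>z\<in>UNIV. g z)"
proof -
  let ?X = "\<Sum>z\<in>UNIV. g z"
  have dir: "(\<Sum>p\<in>UNIV. g p * line_sum g p v) = 4 * ?X" if "v \<noteq> 0" for v
  proof -
    have sq: "line_sum g p v * line_sum g p v = 4 * line_sum g p v" for p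
      using binary_line_sumsD[OF g that, of p] by auto
    \<comment> \<open>The line sum is constant along the line, so adding up the four translates by
      multiples of \<open>v\<close> turns the factor \<open>g p\<close> into a second line
      sum.\<close>
    have "4 * (\<Sum>p\<in>UNIV. g p * line_sum g p v)
        = (\<Sum>k\<in>(UNIV::'a set). \<Sum>p\<in>UNIV. g p * line_sum g p v)"
      by (simp add: q4)
    also have "\<dots> = (\<Sum>k\<in>(UNIV::'a set). \<Sum>p\<in>UNIV. g (p + k *s v) * line_sum g p v)"
    proof (rule sum.cong[OF refl])
      fix k :: 'a
      show "(\<Sum>p\<in>UNIV. g p * line_sum g p v) = (\<Sum>p\<in>UNIV. g (p + k *s v) * line_sum g p v)"
        using sum_shift(1)[of "\<lambda>p. g p * line_sum g p v" "k *s v"] by (simp add: line_sum_translate)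
    qed
    also have "\<dots> = (\<Sum>p\<in>UNIV. line_sum g p v * line_sum g p v)"
      by (subst sum.swap) (simp add: line_sum_def sum_distrib_right)
    also have "\<dots> = 4 * (4 * ?X)"
      using sum_line_sum[of g v] by (simp add: sq sum_distrib_left[symmetric] q4)
    finally show ?thesis by simp
  qed
  have "(\<Sum>p\<in>UNIV. g p * (\<Sum>v\<in>-{0}. line_sum g p v)) = (\<Sum>v\<in>-{0}. \<Sum>p\<in>UNIV. g p * line_sum g p v)"
    by (simp add: sum_distrib_left) (rule sum.swap)
  also have "\<dots> = 4 * int (CARD('a ^ 'n) - 1) * ?X"
    by (simp add: dir card_nonzero)
  finally have *: "(\<Sum>p\<in>UNIV. g p * (int (CARD('a ^ 'n) - 4) * g p + 3 * ?X)) = 4 * int (CARD('a ^ 'n) - 1) * ?X"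
    by (simp only: sum_line_sum_directions[OF q4] of_int_of_nat_eq)
  have "g p * (c * g p + 3 * ?X) = c * (g p)\<^sup>2 + (3 * ?X) * g p" for p and c :: int
    by (simp add: algebra_simps power2_eq_square)
  with * show ?thesis
    by (simp only: sum.distrib sum_distrib_left[symmetric]) (simp add: power2_eq_square)
qed

text \<open>The set splits into orbits under the three nonzero scalars, and each orbit of a nonzero
  vector has exactly three elements.\<close>

lemma three_dvd_card_scale_invariant:
  fixes A :: "('a::{field,finite} ^ 'n) set"
  assumes q4: "CARD('a) = 4" and "0 \<notin> A" and scale: "\<And>c v. c \<noteq> 0 \<Longrightarrow> v \<in> A \<Longrightarrow> c *s v \<in> A"
  shows "3 dvd card A"
proof -
  define C where "C = (\<lambda>v. (\<lambda>c. c *s v) ` (- {0})) ` A"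
  have A: "\<Union>C = A"
  proof
    show "A \<subseteq> \<Union>C"
    proof
      fix v assume "v \<in> A"
      moreover have "v \<in> (\<lambda>c. c *s v) ` (- {0})"
        by (rule image_eqI[of _ _ 1]) auto
      ultimately show "v \<in> \<Union>C" by (auto simp: C_def)
    qed
  qed (auto simp: C_def intro: scale)
  have "card c = 3" if c: "c \<in> C" for c
  proof -
    obtain v where v: "v \<in> A" "c = (\<lambda>c. c *s v) ` (- {0})" using c unfolding C_def by blast
    have "inj_on (\<lambda>c. c *s v) (- {0})"
      using v(1) assms(2) by (auto simp: inj_on_def vector_mul_rcancel)
    then show ?thesis by (simp add: v card_image card_nonzero q4)
  qed
  moreover have "c1 \<inter> c2 = {}" if C: "c1 \<in> C" "c2 \<in> C" "c1 \<noteq> c2" for c1 c2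
  proof (rule ccontr)
    assume "c1 \<inter> c2 \<noteq> {}"
    have sub: "(\<lambda>c. c *s v) ` (- {0}) \<subseteq> (\<lambda>c. c *s w) ` (- {0})"
      if "a *s v = b *s w" "a \<noteq> 0" "b \<noteq> 0" for a b :: 'a and v w :: "'a ^ 'n"
    proof -
      have "v = (b / a) *s w"
        using that by (metis field_class.field_divide_inverse left_inverse mult.commute vector_smult_assoc vector_smult_lid)
      then show ?thesis using that by (auto simp: vector_smult_assoc)
    qed
    from \<open>c1 \<inter> c2 \<noteq> {}\<close> C(1,2) obtain v w a b where
      "c1 = (\<lambda>c. c *s v) ` (- {0})" "c2 = (\<lambda>c. c *s w) ` (- {0})" "a *s v = b *s w" "a \<noteq> 0" "b \<noteq> 0"
      by (auto simp: C_def)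
    then have "c1 = c2" using sub[of a v b w] sub[of b w a v] by auto
    then show False using C(3) by simp
  qed
  ultimately have "3 dvd card (\<Union>C)"
    by (intro dvd_partition) auto
  then show ?thesis by (simp add: A)
qed

section \<open>Plane sections and parallel classes of planes\<close>

text \<open>Written in coordinates with respect to the frame \<open>p\<close>, \<open>v\<close>,
  \<open>w\<close>, the restriction to a plane is a function on \<open>'a ^ 2\<close>, to which the
  dimension-free identities apply.\<close>

definition plane_section :: "('a::{field,finite} ^ 3 \<Rightarrow> 'b) \<Rightarrow> 'a ^ 3 \<Rightarrow> 'a ^ 3 \<Rightarrow> 'a ^ 3 \<Rightarrow> 'a ^ 2 \<Rightarrow> 'b" where
  "plane_section g p v w y = g (p + y$1 *s v + y$2 *s w)"

lemma line_sum_plane_section: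
  "line_sum (plane_section g p v w) y d = line_sum g (p + y$1 *s v + y$2 *s w) (d$1 *s v + d$2 *s w)"
  unfolding line_sum_def plane_section_def
  by (intro sum.cong refl arg_cong[of _ _ g])
    (simp add: vector_sadd_rdistrib vector_add_ldistrib vector_smult_assoc add_ac)

lemma sum_vec2:
  fixes f :: "'a::{field,finite} ^ 2 \<Rightarrow> 'b::comm_monoid_add"
  shows "(\<Sum>y\<in>UNIV. f y) = (\<Sum>s\<in>UNIV. \<Sum>t\<in>UNIV. f (vector [s, t]))"
proof -
  have "(\<Sum>y\<in>UNIV. f y) = (\<Sum>(s,t)\<in>UNIV\<times>UNIV. f (vector [s, t]))"
    by (rule sum.reindex_bij_witness[where i="\<lambda>(s,t). vector [s,t]" and j="\<lambda>y. (y$1, y$2)"])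
      (auto simp: vec_eq_iff forall_2 intro!: arg_cong[of _ _ f])
  also have "\<dots> = (\<Sum>s\<in>UNIV. \<Sum>t\<in>UNIV. f (vector [s, t]))"
    by (rule sum.cartesian_product[symmetric])
  finally show ?thesis .
qed

definition independent2 :: "'a::field ^ 'n \<Rightarrow> 'a ^ 'n \<Rightarrow> bool" where
  "independent2 v w \<longleftrightarrow> (\<forall>s t. s *s v + t *s w = 0 \<longrightarrow> s = 0 \<and> t = 0)"

definition independent3 :: "'a::field ^ 'n \<Rightarrow> 'a ^ 'n \<Rightarrow> 'a ^ 'n \<Rightarrow> bool" where
  "independent3 u v w \<longleftrightarrow> (\<forall>r s t. r *s u + s *s v + t *s w = 0 \<longrightarrow> r = 0 \<and> s = 0 \<and> t = 0)"

lemma independent3_independent2: "independent3 u v w \<Longrightarrow> independent2 v w"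
  unfolding independent2_def independent3_def by (metis add.left_neutral vector_smult_lzero)

lemma binary_line_sums_section:
  assumes "binary_line_sums g" "independent2 v w"
  shows "binary_line_sums (plane_section g p v w)"
  unfolding binary_line_sums_def
proof (intro allI impI)
  fix y d :: "'a ^ 2"
  assume "d \<noteq> 0"
  then have "d$1 \<noteq> 0 \<or> d$2 \<noteq> 0" by (simp add: vec_eq_iff forall_2)
  then have "d$1 *s v + d$2 *s w \<noteq> 0"
    using assms(2) unfolding independent2_def by blast
  then show "line_sum (plane_section g p v w) y d \<in> {0, 4}"
    using assms(1) unfolding binary_line_sums_def line_sum_plane_section by blast
qed

text \<open>The plane is the disjoint union of the lines of one parallel class, each with sum 0 or
  4.\<close>

lemma section_sum_dvd:
  fixes G :: "'a::{field,finite} ^ 2 \<Rightarrow> int"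
  assumes "binary_line_sums G"
  shows "4 dvd (\<Sum>y\<in>UNIV. G y)"
proof -
  have "(\<Sum>y\<in>UNIV. G y) = (\<Sum>s\<in>UNIV. line_sum G (vector [s, 0]) (vector [0, 1]))"
    unfolding sum_vec2 line_sum_def
    by (intro sum.cong refl arg_cong[of _ _ G]) (auto simp: vec_eq_iff forall_2)
  also have "4 dvd \<dots>"
  proof (rule dvd_sum)
    fix s :: 'a
    have "(vector [0, 1] :: 'a ^ 2) \<noteq> 0" by (auto simp: vec_eq_iff forall_2)
    from binary_line_sumsD[OF assms this, of "vector [s, 0]"]
    show "4 dvd line_sum G (vector [s, 0]) (vector [0, 1])" by auto
  qed
  finally show ?thesis .
qed

lemma bij_frame:
  fixes u v w :: "'a::{field,finite} ^ 3"
  assumes "independent3 u v w"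
  shows "bij (\<lambda>(r, y :: 'a ^ 2). p + r *s u + y$1 *s v + y$2 *s w)" (is "bij ?F")
proof -
  have inj: "inj ?F"
  proof (rule injI, clarify)
    fix r r' :: 'a and y y' :: "'a ^ 2"
    assume "p + r *s u + y$1 *s v + y$2 *s w = p + r' *s u + y'$1 *s v + y'$2 *s w"
    then have "(r - r') *s u + (y$1 - y'$1) *s v + (y$2 - y'$2) *s w = 0"
      by (simp add: vector_sub_rdistrib algebra_simps)
    then have "r - r' = 0 \<and> y$1 - y'$1 = 0 \<and> y$2 - y'$2 = 0"
      using assms unfolding independent3_def by blast
    then show "r = r' \<and> y = y'" by (simp add: vec_eq_iff forall_2)
  qed
  \<comment> \<open>Domain and codomain both have \<open>CARD('a) ^ 3\<close> elements, so
    injectivity gives surjectivity.\<close>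
  have "card (range ?F) = CARD('a ^ 3)"
    by (subst card_image[OF inj]) (simp add: card_prod power3_eq_cube power2_eq_square)
  then have "range ?F = UNIV" by (intro card_subset_eq) auto
  with inj show ?thesis by (simp add: bij_def)
qed

lemma sum_parallel_sections:
  fixes g :: "'a::{field,finite} ^ 3 \<Rightarrow> 'b::comm_monoid_add"
  assumes "independent3 u v w"
  shows "(\<Sum>r\<in>UNIV. \<Sum>y\<in>UNIV. plane_section g (p + r *s u) v w y) = (\<Sum>z\<in>UNIV. g z)"
proof -
  have "(\<Sum>z\<in>UNIV. g z) = (\<Sum>(r,y)\<in>UNIV. g (p + r *s u + y$1 *s v + (y :: 'a ^ 2)$2 *s w))"
    using sum.reindex_bij_betw[OF bij_frame[OF assms], of g p] by (simp add: case_prod_beta)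
  also have "\<dots> = (\<Sum>(r,y)\<in>UNIV\<times>UNIV. plane_section g (p + r *s u) v w y)"
    by (simp add: plane_section_def)
  also have "\<dots> = (\<Sum>r\<in>UNIV. \<Sum>y\<in>UNIV. plane_section g (p + r *s u) v w y)"
    by (rule sum.cartesian_product[symmetric])
  finally show ?thesis by (rule sym)
qed

section \<open>From spreads to line sums\<close>

definition affine_line :: "'a::field ^ 3 \<Rightarrow> 'a ^ 3 \<Rightarrow> ('a ^ 3) set" where
  "affine_line p v = {p + t *s v | t. True}"

lemma AG_lines_eq: "AG_lines = {affine_line p v | p v. v \<noteq> 0}"
  by (simp add: AG_lines_def affine_line_def)

lemma mem_affine_line: "q \<in> affine_line p v \<longleftrightarrow> (\<exists>k. q = p + k *s v)"
  by (auto simp: affine_line_def)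

lemma self_mem_affine_line: "p \<in> affine_line p v"
  unfolding mem_affine_line by (rule exI[of _ 0]) simp

lemma affine_line_translate: "affine_line (p + c *s v) v = affine_line p v"
proof -
  have "\<exists>k'. p + c *s v + k *s v = p + k' *s v" for k
    by (rule exI[of _ "c + k"]) (simp add: vector_sadd_rdistrib add.assoc)
  moreover have "\<exists>k'. p + k *s v = p + c *s v + k' *s v" for k
    by (rule exI[of _ "k - c"]) (simp add: vector_sub_rdistrib)
  ultimately show ?thesis unfolding affine_line_def by auto
qed

lemma affine_line_scale:
  assumes "c \<noteq> 0"
  shows "affine_line p (c *s v) = affine_line p v"
proof -
  have "\<exists>k'. p + k *s v = p + k' *s (c *s v)" for k
    by (rule exI[of _ "k / c"]) (simp add: vector_smult_assoc assms)
  then show ?thesis unfolding affine_line_def by (auto simp: vector_smult_assoc)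
qed

lemma card_affine_line:
  fixes v :: "'a::{field,finite} ^ 3"
  assumes "v \<noteq> 0"
  shows "card (affine_line p v) = CARD('a)"
proof -
  have "affine_line p v = range (\<lambda>t. p + t *s v)" by (auto simp: affine_line_def)
  moreover have "inj (\<lambda>t. p + t *s v)" using assms by (auto simp: inj_def vector_mul_rcancel)
  ultimately show ?thesis by (simp add: card_image)
qed

text \<open>A spread is encoded by the direction \<open>D z\<close> of its line through each point \<open>z\<close>.\<close>

lemma card_direction_spread:
  fixes L :: "('a::{field,finite} ^ 3) set set"
  assumes L: "CL_line_class_param x L" and nz: "\<And>z. D z \<noteq> 0" and D: "\<And>z c. D (z + c *s D z) = D z"
  shows "card {z. affine_line z (D z) \<in> L} = CARD('a) * x"
proof -
  define S where "S = range (\<lambda>z. affine_line z (D z))"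
  \<comment> \<open>Constancy of \<open>D\<close> along its own lines makes two such lines that meet
    coincide; this is what turns the family into a partition.\<close>
  have eq: "affine_line q (D q) = affine_line z (D z)" if "q \<in> affine_line z (D z)" for q z
    using that D by (auto simp: mem_affine_line affine_line_translate)
  have "S \<subseteq> AG_lines" using nz by (auto simp: S_def AG_lines_eq)
  moreover have "disjoint S"
    unfolding disjoint_def S_def using eq by blast
  moreover have "\<Union>S = UNIV" "{} \<notin> S"
    using self_mem_affine_line unfolding S_def by blast+
  ultimately have "line_spread S" by (simp add: line_spread_def partition_on_def)
  then have x: "card (L \<inter> S) = x" using L by (simp add: CL_line_class_param_def)
  \<comment> \<open>These points are covered by the \<open>x\<close> lines of \<open>L\<close> in
    the spread, pairwise disjoint and with \<open>CARD('a)\<close> points each.\<close>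
  have "{z. affine_line z (D z) \<in> L} = \<Union>(L \<inter> S)"
  proof (intro equalityI subsetI)
    fix z assume "z \<in> {z. affine_line z (D z) \<in> L}"
    then show "z \<in> \<Union>(L \<inter> S)" using self_mem_affine_line unfolding S_def by blast
  next
    fix q assume "q \<in> \<Union>(L \<inter> S)"
    then obtain z where "q \<in> affine_line z (D z)" "affine_line z (D z) \<in> L" by (auto simp: S_def)
    then show "q \<in> {z. affine_line z (D z) \<in> L}" using eq by simp
  qed
  moreover have "card (\<Union>(L \<inter> S)) = (\<Sum>l\<in>L \<inter> S. card l)"
    using \<open>disjoint S\<close> by (intro card_Union_disjoint) (auto simp: disjoint_def pairwise_def disjnt_def)
  moreover have "\<dots> = (\<Sum>l\<in>L \<inter> S. CARD('a))"
    by (rule sum.cong) (auto simp: S_def card_affine_line nz)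
  ultimately show ?thesis by (simp add: x)
qed

section \<open>Equidistribution over the parallel classes of a plane\<close>

definition line_indicator :: "('a::field ^ 3) set set \<Rightarrow> 'a ^ 3 \<Rightarrow> 'a ^ 3 \<Rightarrow> real" where
  "line_indicator L p v = of_bool (affine_line p v \<in> L)"

lemma line_indicator_translate: "line_indicator L (p + c *s v) v = line_indicator L p v"
  by (simp add: line_indicator_def affine_line_translate)

lemma line_indicator_scale: "c \<noteq> 0 \<Longrightarrow> line_indicator L p (c *s v) = line_indicator L p v"
  by (simp add: line_indicator_def affine_line_scale)

lemma sum_line_indicator:
  fixes L :: "('a::{field,finite} ^ 3) set set"
  assumes "CL_line_class_param x L" "\<And>z. D z \<noteq> 0" "\<And>z c. D (z + c *s D z) = D z"
  shows "(\<Sum>z\<in>UNIV. line_indicator L z (D z)) = real (CARD('a) * x)"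
  using card_direction_spread[OF assms] by (simp add: line_indicator_def)

text \<open>Compare the parallel class of \<open>v\<close> with the spread obtained from it by
  rotating the lines inside one plane from direction \<open>v\<close> to direction \<open>w\<close>.\<close>

lemma exchange_directions:
  fixes L :: "('a::{field,finite} ^ 3) set set"
  assumes L: "CL_line_class_param x L" and ind: "independent2 v w"
  shows "(\<Sum>t\<in>UNIV. line_indicator L (p + t *s v) w) = (\<Sum>s\<in>UNIV. line_indicator L (p + s *s w) v)"
proof -
  let ?h = "line_indicator L"
  define P where "P = (\<lambda>(s, t). p + s *s v + t *s w) ` (UNIV \<times> UNIV)"
  have memP: "z \<in> P \<longleftrightarrow> (\<exists>s t. z = p + s *s v + t *s w)" for z
    by (auto simp: P_def)
  have P_w: "z + c *s w \<in> P" if "z \<in> P" for z c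
  proof -
    obtain s t where "z = p + s *s v + t *s w" using \<open>z \<in> P\<close> memP by blast
    then have "z + c *s w = p + s *s v + (t + c) *s w" by (simp add: vector_sadd_rdistrib add.assoc)
    then show ?thesis using memP by blast
  qed
  have P_v: "z \<in> P" if "z + c *s v \<in> P" for z c
  proof -
    obtain s t where "z + c *s v = p + s *s v + t *s w" using \<open>z + c *s v \<in> P\<close> memP by blast
    then have "z = p + (s - c) *s v + t *s w" by (simp add: vector_sub_rdistrib algebra_simps)
    then show ?thesis using memP by blast
  qed
  have nz: "v \<noteq> 0" "w \<noteq> 0"
    using ind unfolding independent2_def by (metis add_0 add_0_right vector_smult_lid vector_smult_lzero zero_neq_one)+
  \<comment> \<open>Both direction fields, \<open>v\<close> everywhere and \<open>w\<close> on the
    plane \<open>P\<close> with \<open>v\<close> off it, are constant along their lines, so both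
    sums equal \<open>CARD('a) * x\<close>. Their difference lives on \<open>P\<close> only.\<close>
  have "(\<Sum>z\<in>UNIV. ?h z v) = (\<Sum>z\<in>UNIV. ?h z (if z \<in> P then w else v))"
  proof -
    have "(\<Sum>z\<in>UNIV. ?h z v) = real (CARD('a) * x)"
      by (rule sum_line_indicator[OF L, of "\<lambda>_. v"]) (simp_all add: nz)
    moreover have "(\<Sum>z\<in>UNIV. ?h z (if z \<in> P then w else v)) = real (CARD('a) * x)"
    proof (rule sum_line_indicator[OF L, of "\<lambda>z. if z \<in> P then w else v"])
      fix z c
      show "(if z + c *s (if z \<in> P then w else v) \<in> P then w else v) = (if z \<in> P then w else v)"
        using P_w[of z c] P_v[of z c] by (cases "z \<in> P") auto
    qed (simp add: nz)
    ultimately show ?thesis by simp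
  qed
  then have "(\<Sum>z\<in>UNIV. ?h z v - ?h z (if z \<in> P then w else v)) = 0"
    by (simp add: sum_subtractf)
  moreover have "(\<Sum>z\<in>UNIV. ?h z v - ?h z (if z \<in> P then w else v)) = (\<Sum>z\<in>P. ?h z v - ?h z w)"
    by (rule sum.mono_neutral_cong_right) auto
  ultimately have "(\<Sum>z\<in>P. ?h z v) = (\<Sum>z\<in>P. ?h z w)" by (simp add: sum_subtractf)
  moreover have "(\<Sum>z\<in>P. f z) = (\<Sum>s\<in>UNIV. \<Sum>t\<in>UNIV. f (p + s *s v + t *s w))" for f :: "'a ^ 3 \<Rightarrow> real"
  proof -
    have "inj_on (\<lambda>(s, t). p + s *s v + t *s w) (UNIV \<times> UNIV)"
    proof (rule inj_onI, clarify)
      fix s t s' t'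
      assume "p + s *s v + t *s w = p + s' *s v + t' *s w"
      then have "(s - s') *s v + (t - t') *s w = 0"
        by (simp add: vector_sub_rdistrib algebra_simps)
      then have "s - s' = 0 \<and> t - t' = 0" using ind unfolding independent2_def by blast
      then show "s = s' \<and> t = t'" by simp
    qed
    then have "(\<Sum>z\<in>P. f z) = (\<Sum>(s,t)\<in>UNIV\<times>UNIV. f (p + s *s v + t *s w))"
      unfolding P_def by (subst sum.reindex) (simp_all add: case_prod_unfold o_def)
    also have "\<dots> = (\<Sum>s\<in>UNIV. \<Sum>t\<in>UNIV. f (p + s *s v + t *s w))"
      by (rule sum.cartesian_product[symmetric])
    finally show ?thesis .
  qed
  ultimately have "(\<Sum>s\<in>UNIV. \<Sum>t\<in>UNIV. ?h (p + s *s v + t *s w) v)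
      = (\<Sum>s\<in>UNIV. \<Sum>t\<in>UNIV. ?h (p + s *s v + t *s w) w)" by simp
  moreover have "?h (p + s *s v + t *s w) v = ?h (p + t *s w) v" for s t
    using line_indicator_translate[of L "p + t *s w" s v] by (simp add: add_ac)
  \<comment> \<open>Each line inside the plane is met once for each of its points, which gives the
    common factor \<open>CARD('a)\<close> to be cancelled.\<close>
  ultimately have "real CARD('a) * (\<Sum>t\<in>UNIV. ?h (p + t *s w) v) = real CARD('a) * (\<Sum>s\<in>UNIV. ?h (p + s *s v) w)"
    by (simp add: line_indicator_translate sum_distrib_left)
  then show ?thesis by simp
qed

section \<open>An integral point weight with line sums 0 and 4\<close>

text \<open>A count of direction vectors: over four scalars it is three times the number of lines of
  \<open>L\<close> on \<open>p\<close>.\<close>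

definition star_size :: "('a::{field,finite} ^ 3) set set \<Rightarrow> 'a ^ 3 \<Rightarrow> real" where
  "star_size L p = (\<Sum>v\<in>-{0}. line_indicator L p v)"

text \<open>Split the directions \<open>w\<close> at the points of the line into multiples of
  \<open>v\<close> and the 60 others. The multiples give \<open>12 * h\<close>, where
  \<open>h\<close> is the indicator of the line. For the others, \<open>exchange_directions\<close>
  replaces lines of direction \<open>w\<close> by lines of direction \<open>v\<close>, which gives
  \<open>60 * h + 3 * (4 * x - 4 * h)\<close>.\<close>

lemma line_sum_star_size:
  fixes L :: "('a::{field,finite} ^ 3) set set"
  assumes q4: "CARD('a) = 4" and L: "CL_line_class_param x L" and v: "v \<noteq> 0"
  shows "line_sum (star_size L) p v = 60 * line_indicator L p v + 12 * real x"
proof -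
  let ?h = "line_indicator L"
  define R where "R = range (\<lambda>k. k *s v)"
  have inj: "inj_on (\<lambda>k. k *s v) A" for A using v by (auto simp: inj_on_def vector_mul_rcancel)
  have "card R = 4" unfolding R_def by (subst card_image[OF inj]) (rule q4)
  then have cR: "card (- R) = 60" by (simp add: Compl_eq_Diff_UNIV card_Diff_subset q4)
  have R0: "0 \<in> R" unfolding R_def by (rule image_eqI[of _ _ 0]) auto
  have R': "R - {0} = (\<lambda>k. k *s v) ` (- {0})" using v by (auto simp: R_def)
  have "(\<Sum>w\<in>R - {0}. \<Sum>k\<in>UNIV. ?h (p + k *s v) w) = (\<Sum>c\<in>-{0::'a}. \<Sum>k\<in>(UNIV :: 'a set). ?h p v)"
    unfolding R' by (subst sum.reindex[OF inj]) (simp add: line_indicator_scale line_indicator_translate)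
  also have "\<dots> = 12 * ?h p v" by (simp add: card_nonzero q4)
  finally have inside: "(\<Sum>w\<in>R - {0}. \<Sum>k\<in>UNIV. ?h (p + k *s v) w) = 12 * ?h p v" .
  have "independent2 v w" if "w \<notin> R" for w
    unfolding independent2_def
  proof (intro allI impI)
    fix s t assume st: "s *s v + t *s w = 0"
    have "t = 0"
    proof (rule ccontr)
      assume "t \<noteq> 0"
      have "t *s w = (- s) *s v" using st by (simp add: eq_neg_iff_add_eq_0 add.commute)
      then have "inverse t *s (t *s w) = inverse t *s ((- s) *s v)" by simp
      then have "w = (inverse t * (- s)) *s v" using \<open>t \<noteq> 0\<close> by (simp only: vector_smult_assoc) simp
      then have "w \<in> R" unfolding R_def by (rule range_eqI)
      with that show False by simp
    qed
    then show "s = 0 \<and> t = 0" using st v by simp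
  qed
  then have "(\<Sum>w\<in>-R. \<Sum>k\<in>UNIV. ?h (p + k *s v) w) = (\<Sum>w\<in>-R. \<Sum>k\<in>UNIV. ?h (p + k *s w) v)"
    by (intro sum.cong refl exchange_directions[OF L]) auto
  also have "\<dots> = (\<Sum>k\<in>UNIV. \<Sum>w\<in>-R. ?h (p + k *s w) v)" by (rule sum.swap)
  also have "\<dots> = 60 * ?h p v + (\<Sum>k\<in>-{0}. \<Sum>w\<in>-R. ?h (p + k *s w) v)"
    by (simp add: sum.remove[of UNIV 0] Compl_eq_Diff_UNIV[symmetric] cR)
  \<comment> \<open>A nonzero scalar permutes the vectors outside the span \<open>R\<close> of
    \<open>v\<close>, so the three nonzero \<open>k\<close> contribute equally.\<close>
  also have "(\<Sum>k\<in>-{0}. \<Sum>w\<in>-R. ?h (p + k *s w) v) = (\<Sum>k\<in>-{0::'a}. \<Sum>w\<in>-R. ?h (p + w) v)"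
  proof (rule sum.cong[OF refl])
    fix k :: 'a assume "k \<in> - {0}"
    moreover have "k *s w \<in> - R \<longleftrightarrow> w \<in> - R" if "k \<noteq> 0" for w
    proof -
      have "w \<in> R" if "k *s w = c *s v" for c
      proof -
        have "w = (inverse k * c) *s v"
          using that \<open>k \<noteq> 0\<close> by (metis left_inverse vector_smult_assoc vector_smult_lid)
        then show ?thesis unfolding R_def by (rule range_eqI)
      qed
      moreover have "k *s w \<in> R" if "w = c *s v" for c
        unfolding R_def by (rule range_eqI[of _ _ "k * c"]) (simp add: that vector_smult_assoc)
      ultimately show ?thesis by (auto simp: R_def)
    qed
    ultimately show "(\<Sum>w\<in>-R. ?h (p + k *s w) v) = (\<Sum>w\<in>-R. ?h (p + w) v)"
      by (intro sum_scale_vec[of k _ "\<lambda>w. ?h (p + w) v"]) auto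
  qed
  \<comment> \<open>The parallel class of \<open>v\<close> has \<open>x\<close> lines in
    \<open>L\<close> with four points each; the line on \<open>p\<close> itself is taken
    off.\<close>
  also have "(\<Sum>w\<in>-R. ?h (p + w) v) = 4 * real x - 4 * ?h p v"
  proof -
    have "(\<Sum>w\<in>UNIV. ?h (p + w) v) = (\<Sum>w\<in>R. ?h (p + w) v) + (\<Sum>w\<in>-R. ?h (p + w) v)"
      by (subst sum.union_disjoint[symmetric]) auto
    moreover have "(\<Sum>w\<in>UNIV. ?h (p + w) v) = 4 * real x"
      using sum_line_indicator[OF L, of "\<lambda>_. v"] v by (simp add: sum_shift(2)[of "\<lambda>z. ?h z v"] q4)
    moreover have "(\<Sum>w\<in>R. ?h (p + w) v) = 4 * ?h p v"
      unfolding R_def by (subst sum.reindex[OF inj]) (simp add: line_indicator_translate q4)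
    ultimately show ?thesis by simp
  qed
  finally have outside: "(\<Sum>w\<in>-R. \<Sum>k\<in>UNIV. ?h (p + k *s v) w)
      = 60 * ?h p v + 3 * (4 * real x - 4 * ?h p v)"
    by (simp add: card_nonzero q4)
  have "line_sum (star_size L) p v = (\<Sum>w\<in>-{0}. \<Sum>k\<in>UNIV. ?h (p + k *s v) w)"
    unfolding line_sum_def star_size_def by (rule sum.swap)
  also have "- {0} = (R - {0}) \<union> (- R)" using R0 by auto
  also have "(\<Sum>w\<in>(R - {0}) \<union> (- R). \<Sum>k\<in>UNIV. ?h (p + k *s v) w)
      = (\<Sum>w\<in>R - {0}. \<Sum>k\<in>UNIV. ?h (p + k *s v) w) + (\<Sum>w\<in>-R. \<Sum>k\<in>UNIV. ?h (p + k *s v) w)"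
    by (rule sum.union_disjoint) auto
  finally show ?thesis by (simp add: inside outside)
qed

text \<open>The directions with sum 4 at \<open>y\<close> number \<open>3 * m\<close>, so
  \<open>12 * m = 12 * G y + 3 * X\<close>, where the total \<open>X\<close> is 4 times the number
  of lines of sum 4 in a parallel class. Hence \<open>G y\<close> is a difference of two natural
  numbers.\<close>

lemma section_integral:
  fixes G :: "'a::{field,finite} ^ 2 \<Rightarrow> real"
  assumes q4: "CARD('a) = 4" and G: "\<And>p v. v \<noteq> 0 \<Longrightarrow> line_sum G p v \<in> {0, 4}"
  shows "G y \<in> \<int>"
proof -
  define A where "A = {v. v \<noteq> 0 \<and> line_sum G y v = 4}"
  have "3 dvd card A"
    by (rule three_dvd_card_scale_invariant[OF q4]) (auto simp: A_def line_sum_scale)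
  then obtain m where m: "card A = 3 * m" by (elim dvdE)
  have "(\<Sum>v\<in>-{0}. line_sum G y v) = (\<Sum>v\<in>-{0}. if v \<in> A then 4 else 0)"
    by (rule sum.cong) (use G[of _ y] in \<open>auto simp: A_def\<close>)
  also have "\<dots> = 12 * real m"
    by (simp add: sum.If_cases A_def Int_def m[unfolded A_def])
  finally have 1: "12 * real m = 12 * G y + 3 * (\<Sum>z\<in>UNIV. G z)"
    by (simp add: sum_line_sum_directions[OF q4] q4)
  have e: "(vector [0, 1] :: 'a ^ 2) \<noteq> 0" by (auto simp: vec_eq_iff forall_2)
  have "(\<Sum>z\<in>UNIV. G z) = (\<Sum>s\<in>UNIV. line_sum G (vector [s, 0]) (vector [0, 1]))"
    unfolding sum_vec2 line_sum_def
    by (intro sum.cong refl arg_cong[of _ _ G]) (auto simp: vec_eq_iff forall_2)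
  also have "\<dots> = (\<Sum>s\<in>UNIV. 4 * of_bool (line_sum G (vector [s, 0]) (vector [0, 1]) = 4))"
    by (rule sum.cong) (use G[OF e] in auto)
  also have "\<dots> = 4 * real (card {s. line_sum G (vector [s, 0]) (vector [0, 1]) = 4})"
    by (simp add: sum_distrib_left[symmetric])
  finally have "G y = real m - real (card {s. line_sum G (vector [s, 0]) (vector [0, 1]) = 4})"
    using 1 by simp
  then show ?thesis by simp
qed

lemma exists_binary_line_sums:
  fixes L :: "('a::{field,finite} ^ 3) set set"
  assumes q4: "CARD('a) = 4" and L: "CL_line_class L"
  shows "\<exists>g :: 'a ^ 3 \<Rightarrow> int. \<forall>p v. v \<noteq> 0 \<longrightarrow> line_sum g p v = (if affine_line p v \<in> L then 4 else 0)"
proof -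
  obtain x where x: "CL_line_class_param x L" using L by (auto simp: CL_line_class_def)
  \<comment> \<open>The shift \<open>3 * x\<close> cancels the constant \<open>12 * x\<close> over
    the four points of a line, and 15 scales the remaining 60 to 4.\<close>
  define f where "f p = (star_size L p - 3 * real x) / 15" for p
  have f: "line_sum f p v = (if affine_line p v \<in> L then 4 else 0)" if "v \<noteq> 0" for p v
  proof -
    have "line_sum f p v = (line_sum (star_size L) p v - 12 * real x) / 15"
      by (simp add: line_sum_def f_def sum_divide_distrib[symmetric] sum_subtractf q4)
    then show ?thesis
      by (simp add: line_sum_star_size[OF q4 x that] line_indicator_def)
  qed
  have int: "f p \<in> \<int>" for p
  proof -
    \<comment> \<open>Integrality needs only one plane through \<open>p\<close>; the plane spanned
      by the first two unit vectors is taken, with \<open>p\<close> at coordinate 0.\<close>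
    define e1 e2 :: "'a ^ 3" where "e1 = vector [1, 0, 0]" and "e2 = vector [0, 1, 0]"
    have "plane_section f p e1 e2 0 \<in> \<int>"
    proof (rule section_integral[OF q4])
      fix y d :: "'a ^ 2" assume "d \<noteq> 0"
      then have "d$1 *s e1 + d$2 *s e2 \<noteq> 0"
        by (auto simp: e1_def e2_def vec_eq_iff forall_2 forall_3)
      then show "line_sum (plane_section f p e1 e2) y d \<in> {0, 4}"
        by (simp add: line_sum_plane_section f)
    qed
    then show ?thesis by (simp add: plane_section_def)
  qed
  define g where "g p = \<lfloor>f p\<rfloor>" for p
  have g: "of_int (g p) = f p" for p using int[of p] by (simp add: g_def)
  have "line_sum g p v = (if affine_line p v \<in> L then 4 else 0)" if "v \<noteq> 0" for p v
  proof -
    have "real_of_int (line_sum g p v) = line_sum f p v"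
      by (simp add: line_sum_def g)
    then show ?thesis using f[OF that, of p] by (auto split: if_splits)
  qed
  then show ?thesis by blast
qed

section \<open>Functions with line sums 0 and 4\<close>

text \<open>For a plane with sum \<open>4 * a\<close> and sum of squares \<open>Q\<close>, the
  quadratic identity reads \<open>12 * Q + 48 * a^2 = 240 * a\<close>. Since
  \<open>Q \<ge> 0\<close>, it also forces \<open>a \<ge> 0\<close>.\<close>

lemma parallel_sections:
  fixes g :: "'a::{field,finite} ^ 3 \<Rightarrow> int"
  assumes q4: "CARD('a) = 4" and g: "binary_line_sums g" and ind: "independent3 u v w"
  shows "\<exists>a. (\<forall>r. (\<Sum>y\<in>UNIV. plane_section g (p + r *s u) v w y) = 4 * a r)
    \<and> (\<forall>r. (\<Sum>y\<in>UNIV. (plane_section g (p + r *s u) v w y)\<^sup>2) = 20 * a r - 4 * (a r)\<^sup>2)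
    \<and> (\<Sum>z\<in>UNIV. g z) = 4 * (\<Sum>r\<in>UNIV. a r)
    \<and> (\<Sum>z\<in>UNIV. (g z)\<^sup>2) = 20 * (\<Sum>r\<in>UNIV. a r) - 4 * (\<Sum>r\<in>UNIV. (a r)\<^sup>2)
    \<and> (\<forall>r. 0 \<le> a r)"
proof -
  let ?G = "\<lambda>r. plane_section g (p + r *s u) v w"
  have good: "binary_line_sums (?G r)" for r
    using binary_line_sums_section[OF g independent3_independent2[OF ind]] .
  define a where "a r = (\<Sum>y\<in>UNIV. ?G r y) div 4" for r
  have a: "(\<Sum>y\<in>UNIV. ?G r y) = 4 * a r" for r
    using section_sum_dvd[OF good[of r]] by (simp add: a_def)
  have a2: "(\<Sum>y\<in>UNIV. (?G r y)\<^sup>2) = 20 * a r - 4 * (a r)\<^sup>2" for r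
    using quadratic_identity[OF q4 good[of r]] by (simp add: a q4 power_mult_distrib)
  have "0 \<le> a r" for r
  proof (rule ccontr)
    assume "\<not> 0 \<le> a r"
    moreover have "0 \<le> 20 * a r - 4 * (a r)\<^sup>2"
      unfolding a2[symmetric] by (rule sum_nonneg) simp
    ultimately show False using zero_le_power2[of "a r"] by linarith
  qed
  moreover have "(\<Sum>z\<in>UNIV. g z) = 4 * (\<Sum>r\<in>UNIV. a r)"
    using sum_parallel_sections[OF ind, of g p] by (simp add: a sum_distrib_left)
  moreover have "(\<Sum>z\<in>UNIV. (g z)\<^sup>2) = 20 * (\<Sum>r\<in>UNIV. a r) - 4 * (\<Sum>r\<in>UNIV. (a r)\<^sup>2)"
    using sum_parallel_sections[OF ind, of "\<lambda>z. (g z)\<^sup>2" p] a2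
    by (simp add: plane_section_def sum_subtractf sum_distrib_left)
  ultimately show ?thesis using a a2 by blast
qed

text \<open>Where \<open>v\<close> has a nonzero coordinate, it can replace the corresponding unit
  vector in the standard basis.\<close>

lemma exists_independent3:
  fixes v :: "'a::field ^ 3"
  assumes "v \<noteq> 0"
  shows "\<exists>u w. independent3 u v w"
proof -
  consider "v$1 \<noteq> 0" | "v$2 \<noteq> 0" | "v$3 \<noteq> 0"
    using assms by (auto simp: vec_eq_iff forall_3)
  then show ?thesis
  proof cases
    case 1
    then have "independent3 (vector [0, 1, 0]) v (vector [0, 0, 1])"
      by (auto simp: independent3_def vec_eq_iff forall_3)
    then show ?thesis by blast
  next
    case 2
    then have "independent3 (vector [1, 0, 0]) v (vector [0, 0, 1])"
      by (auto simp: independent3_def vec_eq_iff forall_3)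
    then show ?thesis by blast
  next
    case 3
    then have "independent3 (vector [1, 0, 0]) v (vector [0, 1, 0])"
      by (auto simp: independent3_def vec_eq_iff forall_3)
    then show ?thesis by blast
  qed
qed

lemma sum_eq_four_param:
  fixes g :: "'a::{field,finite} ^ 3 \<Rightarrow> int"
  assumes q4: "CARD('a) = 4" and g: "binary_line_sums g"
  obtains x where "(\<Sum>z\<in>UNIV. g z) = 4 * x"
proof -
  have "(vector [1, 0, 0] :: 'a ^ 3) \<noteq> 0" by (simp add: vec_eq_iff forall_3)
  then obtain u v w :: "'a ^ 3" where "independent3 u v w" using exists_independent3 by blast
  from parallel_sections[OF q4 g this] that show thesis by metis
qed

text \<open>The general identities with 64 points. The bounds on values hold because at most 63
  directions exist; those on \<open>x\<close> come from adding the line sums of one direction over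
  all points, a total of \<open>16 * x\<close> between 0 and 256.\<close>

lemma param_bounds:
  fixes g :: "'a::{field,finite} ^ 3 \<Rightarrow> int"
  assumes q4: "CARD('a) = 4" and g: "binary_line_sums g" and x: "(\<Sum>z\<in>UNIV. g z) = 4 * x"
  shows card_full_directions_param: "int (card (full_directions g p)) = 15 * g p + 3 * x"
    and value_lower_bound: "0 \<le> 5 * g p + x" and value_upper_bound: "5 * g p + x \<le> 21"
    and sum_squares_param: "5 * (\<Sum>z\<in>UNIV. (g z)\<^sup>2) = 84 * x - 4 * x\<^sup>2"
    and "0 \<le> x" "x \<le> 16"
proof -
  show card: "int (card (full_directions g p)) = 15 * g p + 3 * x" for p
    using card_full_directions[OF q4 g, of p] by (simp add: x q4)
  have "card (full_directions g p) \<le> card (- {0 :: 'a ^ 3})"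
    by (rule card_mono) (auto simp: full_directions_def)
  then have "card (full_directions g p) \<le> 63" by (simp add: card_nonzero q4)
  with card[of p] show "0 \<le> 5 * g p + x" "5 * g p + x \<le> 21" by linarith+
  show "5 * (\<Sum>z\<in>UNIV. (g z)\<^sup>2) = 84 * x - 4 * x\<^sup>2"
    using quadratic_identity[OF q4 g] by (simp add: x q4 power_mult_distrib)
  define v :: "'a ^ 3" where "v = vector [1, 0, 0]"
  have "v \<noteq> 0" by (simp add: v_def vec_eq_iff forall_3)
  then have line: "0 \<le> line_sum g p v" "line_sum g p v \<le> 4" for p
    using binary_line_sumsD[OF g, of v p] by auto
  have "(\<Sum>p\<in>UNIV. line_sum g p v) = 16 * x"
    using sum_line_sum[of g v] by (simp add: q4 x)
  moreover have "0 \<le> (\<Sum>p\<in>UNIV. line_sum g p v)" by (simp add: sum_nonneg line)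
  moreover have "(\<Sum>p\<in>UNIV. line_sum g p v) \<le> (\<Sum>p\<in>(UNIV :: ('a ^ 3) set). 4)"
    by (rule sum_mono) (rule line)
  ultimately show "0 \<le> x" "x \<le> 16" by (simp_all add: q4)
qed

text \<open>The second moment is an integer, so 5 divides \<open>4 * x * (21 - x)\<close> and
  \<open>x\<close> is 0 or 1 modulo 5.\<close>

lemma param_cases:
  fixes g :: "'a::{field,finite} ^ 3 \<Rightarrow> int"
  assumes q4: "CARD('a) = 4" and g: "binary_line_sums g" and x: "(\<Sum>z\<in>UNIV. g z) = 4 * x"
  shows "x \<in> {0, 1, 5, 6, 10, 11, 15, 16}"
proof -
  define Q where "Q = (\<Sum>z\<in>UNIV. (g z)\<^sup>2)"
  have Q: "5 * Q = 84 * x - 4 * x\<^sup>2" "0 \<le> x" "x \<le> 16"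
    using param_bounds[OF q4 g x] by (auto simp: Q_def)
  have "x \<in> {0,1,2,3,4,5,6,7,8,9,10,11,12,13,14,15,16}"
    using Q(2,3) unfolding insert_iff empty_iff by presburger
  then show ?thesis using Q(1) by (elim insertE) (simp_all, presburger+)
qed

section \<open>Point masses and the parameters 0 and 1\<close>

lemma line_sum_delta:
  fixes v :: "'a::{field,finite} ^ 'n"
  assumes "v \<noteq> 0"
  shows "line_sum (\<lambda>z. if z = p then c else 0) q v = (if \<exists>k. p = q + k *s v then c else 0)"
proof (cases "\<exists>k. p = q + k *s v")
  case True
  then obtain k0 where k0: "p = q + k0 *s v" by blast
  have "q + k *s v = p \<longleftrightarrow> k = k0" for k
    using assms by (auto simp: k0 vector_mul_rcancel)
  then show ?thesis using True by (simp add: line_sum_def)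
next
  case False
  then show ?thesis unfolding line_sum_def by (auto intro!: sum.neutral)
qed

lemma param_0:
  fixes g :: "'a::{field,finite} ^ 3 \<Rightarrow> int"
  assumes q4: "CARD('a) = 4" and g: "binary_line_sums g" and x: "(\<Sum>z\<in>UNIV. g z) = 0"
  shows "g = (\<lambda>z. 0)"
proof -
  have "(\<Sum>z\<in>UNIV. (g z)\<^sup>2) = 0" using sum_squares_param[OF q4 g, of 0] x by simp
  then show ?thesis by (auto simp: sum_nonneg_eq_0_iff)
qed

text \<open>The values lie between 0 and 4, and both the sum of squares and 4 times the sum equal
  16. So the nonnegative terms \<open>g z * (4 - g z)\<close> vanish, and the total 4 leaves room
  for one point only.\<close>

lemma param_1:
  fixes g :: "'a::{field,finite} ^ 3 \<Rightarrow> int"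
  assumes q4: "CARD('a) = 4" and g: "binary_line_sums g" and x: "(\<Sum>z\<in>UNIV. g z) = 4"
  shows "\<exists>p. g = (\<lambda>z. if z = p then 4 else 0)"
proof -
  have x1: "(\<Sum>z\<in>UNIV. g z) = 4 * 1" using x by simp
  have range: "0 \<le> g z" "g z \<le> 4" for z
    using value_lower_bound[OF q4 g x1, of z] value_upper_bound[OF q4 g x1, of z] by auto
  have "(\<Sum>z\<in>UNIV. g z * (4 - g z)) = 0"
    using sum_squares_param[OF q4 g x1] x
    by (simp add: algebra_simps sum_subtractf sum_distrib_left[symmetric] sum_distrib_right[symmetric] power2_eq_square)
  then have vals: "g z = 0 \<or> g z = 4" for z
    by (subst (asm) sum_nonneg_eq_0_iff) (auto simp: range)
  have "\<exists>p. g p \<noteq> 0"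
  proof (rule ccontr)
    assume "\<nexists>p. g p \<noteq> 0"
    with x show False by simp
  qed
  then obtain p where "g p \<noteq> 0" by blast
  with vals have p: "g p = 4" by auto
  have "(\<Sum>z\<in>UNIV - {p}. g z) = 0"
    using x p by (subst (asm) sum.remove[of _ p]) auto
  then have "g z = 0" if "z \<noteq> p" for z
    using that by (subst (asm) sum_nonneg_eq_0_iff) (auto simp: range)
  with p show ?thesis by (intro exI[of _ p]) auto
qed

lemma binary_line_sums_complement:
  assumes q4: "CARD('a::{field,finite}) = 4" and g: "binary_line_sums (g :: 'a ^ 'n \<Rightarrow> int)"
  shows "binary_line_sums (\<lambda>z. 1 - g z)"
  unfolding binary_line_sums_def
proof (intro allI impI)
  fix p v :: "'a ^ 'n" assume "v \<noteq> 0"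
  moreover have "line_sum (\<lambda>z. 1 - g z) p v = 4 - line_sum g p v"
    by (simp add: line_sum_def sum_subtractf q4)
  ultimately show "line_sum (\<lambda>z. 1 - g z) p v \<in> {0, 4}"
    using binary_line_sumsD[OF g, of v p] by auto
qed

section \<open>Exclusion of the parameter 5\<close>

lemma not_param_5:
  fixes g :: "'a::{field,finite} ^ 3 \<Rightarrow> int"
  assumes q4: "CARD('a) = 4" and g: "binary_line_sums g"
  shows "(\<Sum>z\<in>UNIV. g z) \<noteq> 20"
proof
  assume "(\<Sum>z\<in>UNIV. g z) = 20"
  then have x: "(\<Sum>z\<in>UNIV. g z) = 4 * 5" by simp
  have "(vector [1, 0, 0] :: 'a ^ 3) \<noteq> 0" by (simp add: vec_eq_iff forall_3)
  then obtain u v w :: "'a ^ 3" where ind: "independent3 u v w" using exists_independent3 by blast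
  obtain a where a: "\<And>r. (\<Sum>y\<in>UNIV. plane_section g (0 + r *s u) v w y) = 4 * a r"
    "\<And>r. (\<Sum>y\<in>UNIV. (plane_section g (0 + r *s u) v w y)\<^sup>2) = 20 * a r - 4 * (a r)\<^sup>2"
    "(\<Sum>z\<in>UNIV. g z) = 4 * (\<Sum>r\<in>UNIV. a r)"
    "(\<Sum>z\<in>UNIV. (g z)\<^sup>2) = 20 * (\<Sum>r\<in>UNIV. a r) - 4 * (\<Sum>r\<in>UNIV. (a r)\<^sup>2)" "\<And>r. 0 \<le> a r"
    using parallel_sections[OF q4 g ind, of 0] by blast
  have sa: "(\<Sum>r\<in>UNIV. a r) = 5" using a(3) x by simp
  have "(\<Sum>r\<in>UNIV. (a r)\<^sup>2) = 9"
    using a(4) sum_squares_param[OF q4 g x] sa by simp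
  then have "(\<Sum>r\<in>UNIV. a r * (a r - 1)) = 4"
    using sa by (simp add: sum_subtractf right_diff_distrib power2_eq_square)
  \<comment> \<open>The terms \<open>a r * (a r - 1)\<close> are 0 for \<open>a r \<le> 1\<close>
    and at least 6 for \<open>a r \<ge> 3\<close>, so a total of 4 needs the value 2.\<close>
  have "\<exists>r. a r = 2"
  proof (rule ccontr)
    assume n2: "\<nexists>r. a r = 2"
    have ge: "0 \<le> a r * (a r - 1)" for r using a(5)[of r] by (cases "a r = 0") auto
    have "a r * (a r - 1) = 0" for r
    proof (rule ccontr)
      assume nz: "a r * (a r - 1) \<noteq> 0"
      moreover have "a r \<noteq> 2" using n2 by blast
      ultimately have "a r \<ge> 3" using a(5)[of r] by auto
      then have "3 * 2 \<le> a r * (a r - 1)" by (intro mult_mono) auto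
      also have "\<dots> \<le> (\<Sum>r\<in>UNIV. a r * (a r - 1))"
        by (rule member_le_sum) (auto simp: ge)
      finally show False using \<open>(\<Sum>r\<in>UNIV. a r * (a r - 1)) = 4\<close> by simp
    qed
    then have "(\<Sum>r\<in>UNIV. a r * (a r - 1)) = 0" by (intro sum.neutral) blast
    then show False using \<open>(\<Sum>r\<in>UNIV. a r * (a r - 1)) = 4\<close> by simp
  qed
  then obtain r where r: "a r = 2" by blast
  define p where "p = 0 + r *s u"
  define G where "G = plane_section g p v w"
  have G: "binary_line_sums G"
    unfolding G_def by (rule binary_line_sums_section[OF g independent3_independent2[OF ind]])
  have S1: "(\<Sum>y\<in>UNIV. G y) = 8" and S2: "(\<Sum>y\<in>UNIV. (G y)\<^sup>2) = 24"
    using a(1,2)[of r] by (simp_all add: r G_def p_def)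
  have Gg: "G y = g (p + y$1 *s v + y$2 *s w)" for y by (simp add: G_def plane_section_def)
  \<comment> \<open>A point of value -1 has \<open>15 * (-1) + 3 * 5 = 0\<close> full directions in
    space, whereas in this plane the count would satisfy \<open>4 * c = 12 * (-1) + 3 * 8\<close>,
    that is \<open>c = 3\<close>.\<close>
  have "G y \<noteq> -1" for y
  proof
    assume m: "G y = -1"
    let ?z = "p + y$1 *s v + y$2 *s w"
    have "card (full_directions g ?z) = 0"
      using card_full_directions_param[OF q4 g x, of ?z] m by (simp add: Gg)
    then have empty: "full_directions g ?z = {}" by simp
    have "full_directions G y = {}"
    proof (rule ccontr)
      assume "full_directions G y \<noteq> {}"
      then obtain d where "line_sum G y d = 4" by (auto simp: full_directions_def)
      then have *: "line_sum g ?z (d$1 *s v + d$2 *s w) = 4"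
        by (simp add: G_def line_sum_plane_section)
      \<comment> \<open>This shows that a direction with line sum 4 is not the zero vector.\<close>
      moreover have "line_sum g ?z 0 = -4"
        using m by (simp add: line_sum_def Gg q4)
      ultimately have "d$1 *s v + d$2 *s w \<in> full_directions g ?z"
        by (auto simp: full_directions_def)
      with empty show False by simp
    qed
    then show False
      using card_full_directions[OF q4 G, of y] by (simp add: S1 m q4)
  qed
  moreover have "-1 \<le> G y" "G y \<le> 3" for y
    using value_lower_bound[OF q4 g x, of "p + y$1 *s v + y$2 *s w"] value_upper_bound[OF q4 g x, of "p + y$1 *s v + y$2 *s w"]
    by (auto simp: Gg)
  ultimately have "G y \<noteq> -1" "-1 \<le> G y" "G y \<le> 3" for y
    by blast+
  then have nonneg: "0 \<le> G y" and le3: "G y \<le> 3" for y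
    by (smt (verit, ccfv_threshold))+
  \<comment> \<open>Two points span a line of sum at most 4, on which the other values are
    nonnegative.\<close>
  have pair: "G y + G z \<le> 4" if "z \<noteq> y" for y z
  proof -
    have "(\<Sum>k\<in>{0,1}. G (y + k *s (z - y))) \<le> line_sum G y (z - y)"
      unfolding line_sum_def by (rule sum_mono2) (auto simp: nonneg)
    moreover have "line_sum G y (z - y) \<le> 4"
      using binary_line_sumsD[OF G, of "z - y" y] that by auto
    ultimately show ?thesis by simp
  qed
  show False
  \<comment> \<open>With a value 3 all others are at most 1, so the sum of squares is at most 9 + 5.
    Otherwise all values are at most 2 and it is at most 2 * 8. Both are below 24.\<close>
  proof (cases "\<exists>y. G y = 3")
    case True
    then obtain y where y: "G y = 3" by blast
    have "(G z)\<^sup>2 \<le> G z" if "z \<noteq> y" for z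
    proof -
      have "G z = 0 \<or> G z = 1" using pair[OF that] nonneg[of z] y by auto
      then show ?thesis by auto
    qed
    then have "(\<Sum>z\<in>UNIV - {y}. (G z)\<^sup>2) \<le> (\<Sum>z\<in>UNIV - {y}. G z)"
      by (intro sum_mono) auto
    moreover have "(\<Sum>z\<in>UNIV. G z) = G y + (\<Sum>z\<in>UNIV - {y}. G z)"
      "(\<Sum>z\<in>UNIV. (G z)\<^sup>2) = (G y)\<^sup>2 + (\<Sum>z\<in>UNIV - {y}. (G z)\<^sup>2)"
      by (simp_all add: sum.remove)
    ultimately show False using S1 S2 y by simp
  next
    case False
    then have "G z \<noteq> 3" for z by blast
    then have "G z \<le> 2" for z using le3[of z] by (simp add: order.order_iff_strict[of _ 3])
    then have "(\<Sum>z\<in>UNIV. (G z)\<^sup>2) \<le> (\<Sum>z\<in>UNIV. 2 * G z)"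
      by (intro sum_mono) (auto simp: power2_eq_square nonneg intro: mult_right_mono)
    then show False using S1 S2 by (simp add: sum_distrib_left[symmetric])
  qed
qed


section \<open>Exclusion of the parameter 6\<close>

text \<open>The only full line on \<open>q\<close> has direction \<open>v\<close>, so the plane
  through it has \<open>12 = -12 + 12 * a\<close>, that is \<open>a = 2\<close>. The other three
  planes of its parallel class then have \<open>a\<close> summing to 4 and squares summing to 8,
  which is impossible if all are at least 1. A plane with \<open>a = 0\<close> has second moment
  0.\<close>

lemma zero_section:
  fixes g :: "'a::{field,finite} ^ 3 \<Rightarrow> int"
  assumes q4: "CARD('a) = 4" and g: "binary_line_sums g" and x: "(\<Sum>z\<in>UNIV. g z) = 4 * 6"
    and q: "g q = -1" and v: "v \<in> full_directions g q" and ind: "independent3 u v w"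
  shows "\<exists>r. \<forall>y. plane_section g (q + r *s u) v w y = 0"
proof -
  obtain a where a: "\<And>r. (\<Sum>y\<in>UNIV. plane_section g (q + r *s u) v w y) = 4 * a r"
    "\<And>r. (\<Sum>y\<in>UNIV. (plane_section g (q + r *s u) v w y)\<^sup>2) = 20 * a r - 4 * (a r)\<^sup>2"
    "(\<Sum>z\<in>UNIV. g z) = 4 * (\<Sum>r\<in>UNIV. a r)"
    "(\<Sum>z\<in>UNIV. (g z)\<^sup>2) = 20 * (\<Sum>r\<in>UNIV. a r) - 4 * (\<Sum>r\<in>UNIV. (a r)\<^sup>2)" "\<And>r. 0 \<le> a r"
    using parallel_sections[OF q4 g ind, of q] by blast
  have sa: "(\<Sum>r\<in>UNIV. a r) = 6" using a(3) x by simp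
  have sa2: "(\<Sum>r\<in>UNIV. (a r)\<^sup>2) = 12" using a(4) sum_squares_param[OF q4 g x] sa by simp
  define G where "G = plane_section g q v w"
  have ind2: "independent2 v w" using ind by (rule independent3_independent2)
  have G: "binary_line_sums G"
    unfolding G_def by (rule binary_line_sums_section[OF g ind2])
  have G0: "G 0 = -1" by (simp add: G_def plane_section_def q)
  have sG: "(\<Sum>y\<in>UNIV. G y) = 4 * a 0" using a(1)[of 0] by (simp add: G_def)
  have line: "line_sum G 0 d = line_sum g q (d$1 *s v + d$2 *s w)" for d
    by (simp add: G_def line_sum_plane_section)
  have inj: "inj_on (\<lambda>d :: 'a ^ 2. d$1 *s v + d$2 *s w) A" for A
  proof (rule inj_onI)
    fix d e :: "'a ^ 2"
    assume "d$1 *s v + d$2 *s w = e$1 *s v + e$2 *s w"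
    then have "(d$1 - e$1) *s v + (d$2 - e$2) *s w = 0"
      by (simp add: vector_sub_rdistrib algebra_simps)
    then have "d$1 - e$1 = 0 \<and> d$2 - e$2 = 0"
      using ind2 unfolding independent2_def by blast
    then show "d = e" by (simp add: vec_eq_iff forall_2)
  qed
  have card3: "card (full_directions g q) = 3"
    using card_full_directions_param[OF q4 g x, of q] q by simp
  have sub: "(\<lambda>d. d$1 *s v + d$2 *s w) ` full_directions G 0 \<subseteq> full_directions g q"
  proof
    fix e assume "e \<in> (\<lambda>d. d$1 *s v + d$2 *s w) ` full_directions G 0"
    then obtain d where d: "e = d$1 *s v + d$2 *s w" "line_sum G 0 d = 4"
      by (auto simp: full_directions_def)
    moreover have "line_sum g q 0 = -4" by (simp add: line_sum_def q q4)
    ultimately show "e \<in> full_directions g q" by (auto simp: full_directions_def line)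
  qed
  have le: "card (full_directions G 0) \<le> 3"
    using card_inj_on_le[OF inj sub finite] card3 by simp
  have "line_sum G 0 (vector [1, 0]) = 4"
    using v by (simp add: line full_directions_def)
  moreover have "(vector [1, 0] :: 'a ^ 2) \<noteq> 0" by (simp add: vec_eq_iff forall_2)
  ultimately have "full_directions G 0 \<noteq> {}" by (auto simp: full_directions_def)
  then have "0 < card (full_directions G 0)" by (simp add: card_gt_0_iff)
  \<comment> \<open>A nonempty set of at most three directions, closed under nonzero scalars, has
    exactly three elements.\<close>
  moreover have "3 dvd card (full_directions G 0)"
    by (rule three_dvd_card_scale_invariant[OF q4]) (auto simp: full_directions_def line_sum_scale)
  ultimately have "card (full_directions G 0) = 3" using le by (auto elim!: dvdE)
  then have a0: "a 0 = 2"
    using card_full_directions[OF q4 G, of 0] by (simp add: sG G0 q4)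
  have "\<exists>r. a r = 0"
  proof (rule ccontr)
    assume "\<nexists>r. a r = 0"
    then have ge1: "1 \<le> a r" for r using a(5)[of r] by (metis int_one_le_iff_zero_less order_le_less)
    \<comment> \<open>After subtracting 1, three nonnegative integers would have sum 1 and sum of
      squares 3.\<close>
    have s1: "(\<Sum>r\<in>-{0}. a r - 1) = 1" and s2: "(\<Sum>r\<in>-{0}. (a r - 1)\<^sup>2) = 3"
    proof -
      have t: "(\<Sum>r\<in>-{0}. a r) = 4" "(\<Sum>r\<in>-{0}. (a r)\<^sup>2) = 8"
        using sa sa2 by (simp_all add: sum.remove[of UNIV 0] a0 Compl_eq_Diff_UNIV)
      then show "(\<Sum>r\<in>-{0}. a r - 1) = 1" by (simp add: sum_subtractf card_nonzero q4)
      from t show "(\<Sum>r\<in>-{0}. (a r - 1)\<^sup>2) = 3"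
        by (simp add: power2_diff sum_subtractf sum.distrib sum_distrib_left[symmetric] card_nonzero q4)
    qed
    have "(a r - 1)\<^sup>2 \<le> a r - 1" if "r \<noteq> 0" for r
    proof -
      have "a r - 1 \<le> (\<Sum>r\<in>-{0}. a r - 1)"
      proof (rule member_le_sum)
        show "0 \<le> a s - 1" for s using ge1[of s] by simp
      qed (use that in auto)
      then have "a r = 1 \<or> a r = 2" using ge1[of r] s1 by auto
      then show ?thesis by auto
    qed
    then have "(\<Sum>r\<in>-{0}. (a r - 1)\<^sup>2) \<le> (\<Sum>r\<in>-{0}. a r - 1)"
      by (intro sum_mono) auto
    then show False using s1 s2 by simp
  qed
  then obtain r where "a r = 0" by blast
  then have "(\<Sum>y\<in>UNIV. (plane_section g (q + r *s u) v w y)\<^sup>2) = 0" using a(2)[of r] by simp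
  then have "\<forall>y. plane_section g (q + r *s u) v w y = 0"
    by (simp add: sum_nonneg_eq_0_iff)
  then show ?thesis by blast
qed

text \<open>Three pairwise non-parallel lines of the affine plane: the first has 4 points, the
  second 3 further ones, and the third at least 2 more after its meetings with the first two are
  removed.\<close>

lemma card_three_lines:
  assumes q4: "CARD('a::{field,finite}) = 4"
  shows "9 \<le> card {(s, t :: 'a). t = r1 \<or> s = r2 \<or> t = r3 + s}"
proof -
  let ?A = "(\<lambda>s :: 'a. (s, r1)) ` UNIV"
  let ?B = "(\<lambda>t :: 'a. (r2, t)) ` (UNIV - {r1})"
  let ?C = "(\<lambda>s :: 'a. (s, r3 + s)) ` (UNIV - {r2, r1 - r3})"
  have "2 \<le> card (UNIV - {r2, r1 - r3})"
    using diff_card_le_card_Diff[of "{r2, r1 - r3}" UNIV] card_insert_le_m1[of 2 "{r1 - r3}" r2]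
    by (simp add: q4)
  then have "2 \<le> card ?C" by (subst card_image) (auto simp: inj_on_def)
  moreover have "card ?A = 4" by (subst card_image) (auto simp: inj_on_def q4)
  moreover have "card ?B = 3" by (subst card_image) (auto simp: inj_on_def q4 card_Diff_singleton)
  moreover have "card (?A \<union> ?B \<union> ?C) = card ?A + card ?B + card ?C"
    by (subst card_Un_disjoint, simp, simp, force, subst card_Un_disjoint) (auto simp: card_Un_disjoint)
  moreover have "?A \<union> ?B \<union> ?C \<subseteq> {(s, t). t = r1 \<or> s = r2 \<or> t = r3 + s}" by auto
  then have "card (?A \<union> ?B \<union> ?C) \<le> card {(s, t). t = r1 \<or> s = r2 \<or> t = r3 + s}"
    by (intro card_mono) auto
  ultimately show ?thesis by linarith
qed

lemma not_param_6:
  fixes g :: "'a::{field,finite} ^ 3 \<Rightarrow> int"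
  assumes q4: "CARD('a) = 4" and g: "binary_line_sums g"
  shows "(\<Sum>z\<in>UNIV. g z) \<noteq> 24"
proof
  assume "(\<Sum>z\<in>UNIV. g z) = 24"
  then have x: "(\<Sum>z\<in>UNIV. g z) = 4 * 6" by simp
  have Q: "(\<Sum>z\<in>UNIV. (g z)\<^sup>2) = 72" using sum_squares_param[OF q4 g x] by simp
  have "g p \<noteq> 3" for p
  proof
    assume p: "g p = 3"
    \<comment> \<open>The count \<open>15 * 3 + 3 * 6 = 63\<close> exhausts all directions, so
      subtracting a point mass 4 at \<open>p\<close> keeps line sums in {0, 4} and lowers the total
      to 20.\<close>
    have "int (card (full_directions g p)) = int (card (- {0 :: 'a ^ 3}))"
      using card_full_directions_param[OF q4 g x, of p] by (simp add: p card_nonzero q4)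
    then have "full_directions g p = - {0}"
      by (intro card_subset_eq) (auto simp: full_directions_def)
    then have full: "line_sum g p v = 4" if "v \<noteq> 0" for v
      using that by (auto simp: full_directions_def)
    let ?g' = "\<lambda>z. g z - (if z = p then 4 else 0)"
    have "binary_line_sums ?g'"
      unfolding binary_line_sums_def
    proof (intro allI impI)
      fix z v :: "'a ^ 3" assume v: "v \<noteq> 0"
      have eq: "line_sum ?g' z v = line_sum g z v - (if \<exists>k. p = z + k *s v then 4 else 0)"
        unfolding line_sum_delta[OF v, symmetric] by (simp add: line_sum_def sum_subtractf)
      show "line_sum ?g' z v \<in> {0, 4}"
      proof (cases "\<exists>k. p = z + k *s v")
        case True
        then have "line_sum g z v = 4" using full[OF v] by (auto simp: line_sum_translate)
        then show ?thesis using True by (simp add: eq)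
      next
        case False
        then show ?thesis using binary_line_sumsD[OF g v, of z] by (auto simp: eq)
      qed
    qed
    from not_param_5[OF q4 this] x show False by (simp add: sum_subtractf)
  qed
  moreover have "-1 \<le> g z" "g z \<le> 3" for z
    using value_lower_bound[OF q4 g x, of z] value_upper_bound[OF q4 g x, of z] by auto
  ultimately have "-1 \<le> g z" "g z \<le> 3" "g z \<noteq> 3" for z
    by blast+
  then have vals: "g z = -1 \<or> g z = 0 \<or> g z = 1 \<or> g z = 2" for z
    by (smt (verit, ccfv_threshold))
  define m where "m = (\<Sum>z\<in>UNIV. if g z = -1 then 1 else (0::int))"
  have m10: "10 \<le> m"
  \<comment> \<open>At a point of value 2, \<open>63 - 48 = 15\<close> direction vectors have line
    sum 0, and each such line carries at least two values -1. Counting over directions gives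
    \<open>30 \<le> 3 * m\<close>. If 2 does not occur, the sum of \<open>g^2 - g\<close>, which is
    48, equals \<open>2 * m\<close>.\<close>
  proof (cases "\<exists>p. g p = 2")
    case True
    then obtain p where p: "g p = 2" by blast
    let ?f = "\<lambda>z. if g z = -1 then 1 else (0::int)"
    let ?A = "- {0} - full_directions g p"
    have "int (card (full_directions g p)) = 48"
      using card_full_directions_param[OF q4 g x, of p] p by simp
    then have "card ?A = 15"
      by (subst card_Diff_subset) (auto simp: full_directions_def card_nonzero q4)
    moreover have "2 \<le> line_sum ?f p v" if "v \<in> ?A" for v
    proof -
      have "line_sum g p v = 0"
        using that binary_line_sumsD[OF g, of v p] by (auto simp: full_directions_def)
      then have "2 = (\<Sum>k\<in>-{0}. - g (p + k *s v))"
        unfolding line_sum_def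
        by (simp add: sum.remove[of UNIV 0] p Compl_eq_Diff_UNIV sum_negf)
      also have "\<dots> \<le> (\<Sum>k\<in>-{0}. ?f (p + k *s v))"
      proof (rule sum_mono)
        fix k
        show "- g (p + k *s v) \<le> ?f (p + k *s v)" using vals[of "p + k *s v"] by auto
      qed
      also have "\<dots> \<le> line_sum ?f p v"
        unfolding line_sum_def by (rule sum_mono2) auto
      finally show ?thesis .
    qed
    then have "(\<Sum>v\<in>?A. 2) \<le> (\<Sum>v\<in>?A. line_sum ?f p v)" by (rule sum_mono)
    moreover have "(\<Sum>v\<in>?A. line_sum ?f p v) \<le> (\<Sum>v\<in>-{0}. line_sum ?f p v)"
      by (rule sum_mono2) (auto simp: line_sum_def intro: sum_nonneg)
    moreover have "(\<Sum>v\<in>-{0}. line_sum ?f p v) = 3 * m"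
      by (subst sum_line_sum_directions[OF q4]) (simp add: p m_def)
    ultimately show ?thesis by simp
  next
    case False
    have "(g z)\<^sup>2 - g z = 2 * (if g z = -1 then 1 else 0)" for z
      using vals[of z] False by auto
    then have "(\<Sum>z\<in>UNIV. (g z)\<^sup>2 - g z) = 2 * m"
      by (simp add: m_def sum_distrib_left)
    then show ?thesis using Q x by (simp add: sum_subtractf)
  qed
  define Z where "Z = {z. g z = 0}"
  \<comment> \<open>The polynomial \<open>(g - 1) * (g - 2)\<close> vanishes at 1 and 2 and takes
    the values 2 at 0 and 6 at -1, so its sum counts the zeros once the values -1 are
    subtracted.\<close>
  have "2 * (if g z = 0 then 1 else 0) = 2 - 3 * g z + (g z)\<^sup>2 - 6 * (if g z = -1 then 1 else (0::int))" for z
    using vals[of z] by auto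
  then have "(\<Sum>z\<in>UNIV. 2 * (if g z = 0 then 1 else 0))
      = (\<Sum>z\<in>UNIV. 2 - 3 * g z + (g z)\<^sup>2 - 6 * (if g z = -1 then 1 else (0::int)))"
    by simp
  also have "\<dots> = 128 - 6 * m"
    by (simp only: sum.distrib sum_subtractf sum_distrib_left[symmetric] m_def[symmetric] Q x) (simp add: q4)
  finally have "2 * int (card Z) = 128 - 6 * m"
    by (simp add: sum_distrib_left[symmetric] Z_def sum.If_cases Int_def)
  then have "int (card Z) \<le> 34" using m10 by simp
  have "\<exists>q. g q = -1"
  proof (rule ccontr)
    assume "\<nexists>q. g q = -1"
    then have "m = 0" by (simp add: m_def)
    with m10 show False by simp
  qed
  then obtain q where q: "g q = -1" by blast
  have "card (full_directions g q) = 3" using card_full_directions_param[OF q4 g x, of q] q by simp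
  then have "full_directions g q \<noteq> {}" by auto
  then obtain v where v: "v \<in> full_directions g q" by blast
  then have "v \<noteq> 0" by (simp add: full_directions_def)
  then obtain u w where ind1: "independent3 u v w" using exists_independent3 by blast
  have ind2: "independent3 w v u"
    using ind1 unfolding independent3_def by (metis (no_types, lifting) add.assoc add.commute)
  have ind3: "independent3 w v (u + w)"
    unfolding independent3_def
  proof (intro allI impI)
    fix r s t assume "r *s w + s *s v + t *s (u + w) = 0"
    then have "(r + t) *s w + s *s v + t *s u = 0"
      by (simp add: vector_add_ldistrib vector_sadd_rdistrib add_ac)
    then have "r + t = 0 \<and> s = 0 \<and> t = 0" using ind2 unfolding independent3_def by blast
    then show "r = 0 \<and> s = 0 \<and> t = 0" by auto
  qed
  \<comment> \<open>The three planes contain the direction \<open>v\<close> and are spanned with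
    \<open>u\<close>, \<open>w\<close> and \<open>u + w\<close>. With \<open>s\<close> and
    \<open>t\<close> the coefficients of \<open>u\<close> and \<open>w\<close>, the zero planes
    parallel to them are \<open>t = r1\<close>, \<open>s = r2\<close> and
    \<open>t = r3 + s\<close>.\<close>
  obtain r1 r2 r3 where r1: "\<And>y. plane_section g (q + r1 *s w) v u y = 0"
    and r2: "\<And>y. plane_section g (q + r2 *s u) v w y = 0"
    and r3: "\<And>y. plane_section g (q + r3 *s w) v (u + w) y = 0"
    using zero_section[OF q4 g x q v] ind1 ind2 ind3 by meson
  let ?T = "{(s, t :: 'a). t = r1 \<or> s = r2 \<or> t = r3 + s}"
  let ?F = "\<lambda>(s, y :: 'a ^ 2). q + s *s u + y$1 *s v + y$2 *s w"
  let ?S = "(\<lambda>(k, s, t). (s, vector [k, t] :: 'a ^ 2)) ` (UNIV \<times> ?T)"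
  have "?F ` ?S \<subseteq> Z"
  proof -
    have "g (q + s *s u + k *s v + t *s w) = 0" if "t = r1 \<or> s = r2 \<or> t = r3 + s" for k s t
      using that
    proof (elim disjE)
      assume "t = r1"
      then show ?thesis using r1[of "vector [k, s]"] by (simp add: plane_section_def add_ac)
    next
      assume "s = r2"
      then show ?thesis using r2[of "vector [k, t]"] by (simp add: plane_section_def add_ac)
    next
      assume "t = r3 + s"
      then show ?thesis using r3[of "vector [k, s]"]
        by (simp add: plane_section_def vector_add_ldistrib vector_sadd_rdistrib add_ac)
    qed
    then have mem: "?F (s, vector [k, t]) \<in> Z" if "(s, t) \<in> ?T" for k s t
      using that by (simp add: Z_def)
    show ?thesis
    proof (rule image_subsetI)
      fix y assume "y \<in> ?S"
      then obtain x where x: "y = (\<lambda>(k, s, t). (s, vector [k, t])) x" "x \<in> UNIV \<times> ?T"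
        by (rule imageE)
      obtain k s t where "x = (k, s, t)" by (cases x)
      with x have "(s, t) \<in> ?T" "y = (s, vector [k, t])" by simp_all
      then show "?F y \<in> Z" using mem by (simp only:)
    qed
  qed
  then have "card (?F ` ?S) \<le> card Z" by (intro card_mono) auto
  moreover have "card (?F ` ?S) = card ?S"
    using bij_frame[OF ind1, of q] by (intro card_image) (auto simp: bij_def intro: inj_on_subset)
  \<comment> \<open>The union of the three planes is a cylinder in direction \<open>v\<close> over
    three lines, with at least \<open>4 * 9 = 36\<close> points against at most 34 zeros.\<close>
  moreover have "card ?S = 4 * card ?T"
    by (subst card_image) (auto simp: inj_on_def vec_eq_iff forall_2 card_cartesian_product q4)
  ultimately show False
    using card_three_lines[OF q4, of r1 r2 r3] \<open>int (card Z) \<le> 34\<close> by linarith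
qed

section \<open>Classification of the weights and of the line classes\<close>

lemma binary_line_sums_cases:
  fixes g :: "'a::{field,finite} ^ 3 \<Rightarrow> int"
  assumes q4: "CARD('a) = 4" and g: "binary_line_sums g"
  shows "g = (\<lambda>z. 0) \<or> (\<exists>p. g = (\<lambda>z. if z = p then 4 else 0)) \<or>
    (\<exists>p. g = (\<lambda>z. 1 - (if z = p then 4 else 0))) \<or> g = (\<lambda>z. 1)"
proof -
  obtain x where x: "(\<Sum>z\<in>UNIV. g z) = 4 * x" using sum_eq_four_param[OF q4 g] .
  let ?h = "\<lambda>z. 1 - g z"
  have h: "binary_line_sums ?h" by (rule binary_line_sums_complement[OF q4 g])
  have sh: "(\<Sum>z\<in>UNIV. ?h z) = 64 - 4 * x" by (simp add: sum_subtractf x q4)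
  have "x \<noteq> 5" "x \<noteq> 6" using not_param_5[OF q4 g] not_param_6[OF q4 g] x by auto
  \<comment> \<open>The complement has parameter \<open>16 - x\<close>, so 10 and 11 become 6 and 5;
    likewise 15 and 16 become 1 and 0 below.\<close>
  moreover have "x \<noteq> 10" "x \<noteq> 11" using not_param_5[OF q4 h] not_param_6[OF q4 h] sh by auto
  ultimately consider "x = 0" | "x = 1" | "x = 15" | "x = 16"
    using param_cases[OF q4 g x] by blast
  then show ?thesis
  proof cases
    case 1
    then show ?thesis using param_0[OF q4 g] x by simp
  next
    case 2
    then show ?thesis using param_1[OF q4 g] x by simp
  next
    case 3
    then obtain p where "?h = (\<lambda>z. if z = p then 4 else 0)" using param_1[OF q4 h] sh by auto
    then have "g = (\<lambda>z. 1 - (if z = p then 4 else 0))" by (auto simp: fun_eq_iff algebra_simps)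
    then show ?thesis by blast
  next
    case 4
    then have "?h = (\<lambda>z. 0)" using param_0[OF q4 h] sh by simp
    then have "g = (\<lambda>z. 1)" by (auto simp: fun_eq_iff)
    then show ?thesis by blast
  qed
qed

theorem theorem6p4:
  fixes L :: "('a::{field,finite} ^ 3) set set"
  assumes "CARD('a) = 4"
    and "CL_line_class L"
  shows "L = {} \<or>
    (\<exists>p. L = lines_through p) \<or>
    (\<exists>p. L = AG_lines - lines_through p) \<or>
    L = AG_lines"
proof -
  obtain g :: "'a ^ 3 \<Rightarrow> int" where
    g: "\<And>p v. v \<noteq> 0 \<Longrightarrow> line_sum g p v = (if affine_line p v \<in> L then 4 else 0)"
    using exists_binary_line_sums[OF assms] by blast
  then have "binary_line_sums g" by (auto simp: binary_line_sums_def)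
  note cases = binary_line_sums_cases[OF assms(1) this]
  have mem: "affine_line p v \<in> L \<longleftrightarrow> line_sum g p v \<noteq> 0" if "v \<noteq> 0" for p v
    using g[OF that] by simp
  \<comment> \<open>The weight determines the class: a line belongs to \<open>L\<close> exactly when
    its sum is nonzero. Each of the four shapes of \<open>g\<close> can therefore be translated into
    a condition \<open>P\<close> on lines.\<close>
  have L: "L = {l \<in> AG_lines. P l}"
    if "\<And>p v. v \<noteq> 0 \<Longrightarrow> line_sum g p v \<noteq> 0 \<longleftrightarrow> P (affine_line p v)" for P
  proof -
    have "L \<subseteq> AG_lines" using assms(2) by (auto simp: CL_line_class_def CL_line_class_param_def)
    moreover have "l \<in> L \<longleftrightarrow> P l" if l: "l \<in> AG_lines" for l
    proof -
      from l obtain p v where "l = affine_line p v" "v \<noteq> 0" by (auto simp: AG_lines_eq)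
      then show ?thesis using mem \<open>\<And>p v. v \<noteq> 0 \<Longrightarrow> line_sum g p v \<noteq> 0 \<longleftrightarrow> P (affine_line p v)\<close> by simp
    qed
    ultimately show ?thesis by blast
  qed
  have delta: "line_sum (\<lambda>z. if z = p then 4 else (0::int)) q v = (if p \<in> affine_line q v then 4 else 0)"
    if "v \<noteq> 0" for p q v :: "'a ^ 3"
    by (simp add: line_sum_delta[OF that] mem_affine_line)
  from cases show ?thesis
  proof (elim disjE exE)
    assume "g = (\<lambda>z. 0)"
    then have "L = {l \<in> AG_lines. False}" by (intro L) (simp add: line_sum_def)
    then show ?thesis by simp
  next
    fix p assume "g = (\<lambda>z. if z = p then 4 else 0)"
    then have "L = {l \<in> AG_lines. p \<in> l}" by (intro L) (simp add: delta)
    then show ?thesis by (auto simp: lines_through_def)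
  next
    fix p assume "g = (\<lambda>z. 1 - (if z = p then 4 else 0))"
    then have "line_sum g q v = 4 - (if p \<in> affine_line q v then 4 else 0)" if "v \<noteq> 0" for q v
      unfolding delta[OF that, symmetric] by (simp add: line_sum_def sum_subtractf assms(1))
    then have "L = {l \<in> AG_lines. p \<notin> l}" by (intro L) simp
    then have "L = AG_lines - lines_through p" by (auto simp: lines_through_def)
    then show ?thesis by blast
  next
    assume "g = (\<lambda>z. 1)"
    then have "L = {l \<in> AG_lines. True}" by (intro L) (simp add: line_sum_def assms(1))
    then show ?thesis by simp
  qed
qed

end
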